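(* Let $p\in\mathcal{H}_1$. (i) Let $\Omega\subset\mathbb{C}$ be a domain and let $\psi\in\Psi(\Omega,e^z)$. If $\psi(p(z),zp'(z),z^2p''(z);z)\in\Omega$ for all $z\in\mathbb{D}$, then $p(z)\prec e^z$. (ii) Let $\Delta=\{w\in\mathbb{C}:|\log w|<1\}$ (the image of $\mathbb{D}$ under $z\mapsto e^z$) and let $\psi\in\Psi(\Delta,e^z)$. If $\psi(p(z),zp'(z),z^2p''(z);z)\prec e^z$, then $p(z)\prec e^z$.
   Context: $\mathbb{D}=\{z\in\mathbb{C}:|z|<1\}$. $\mathcal{H}_1$ is the class of analytic functions on $\mathbb{D}$ of the form $p(z)=1+a_1z+a_2z^2+\cdots$. For functions $F,G$ analytic in $\mathbb{D}$, $F\prec G$ (F is subordinate to G) means there is an analytic $w:\mathbb{D}\to\mathbb{C}$ with $w(0)=0$, $|w(z)|<1$ and $F(z)=G(w(z))$ for all $z\in\mathbb{D}$; writing $F\prec G$ presupposes that $F$ and $G$ are analytic in $\mathbb{D}$. For a domain $\Omega\subset\mathbb{C}$, $\Psi(\Omega,e^z)$ is the class of functions $\psi:\mathbb{C}^3\times\mathbb{D}\to\mathbb{C}$ satisfying the admissibility condition: $\psi(r,s,t;z)\notin\Omega$ whenever $r=e^{e^{i\theta}}$, $s=me^{i\theta}r$ and $\operatorname{Re}(1+t/s)\ge m(1+\cos\theta)$, for every $z\in\mathbb{D}$, $\theta\in[0,2\pi)$ and real $m\ge 1$. *)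

theory Defs
  imports "HOL-Complex_Analysis.Complex_Analysis"
begin

abbreviation unit_disc :: "complex set" (\<open>\<D>\<close>)
  where "\<D> \<equiv> ball 0 1"

definition H1 :: "(complex \<Rightarrow> complex) set" (\<open>\<H>\<^sub>1\<close>)
  where "\<H>\<^sub>1 = {p. p analytic_on \<D> \<and>
    (\<exists>a :: nat \<Rightarrow> complex. a 0 = 1 \<and> (\<forall>z\<in>\<D>. (\<lambda>n. a n * z ^ n) sums p z))}"

text \<open>Only the values of \<open>F\<close> and \<open>G\<close> on the open unit disc matter. Writing
  \<open>F \<prec> G\<close> presupposes that both are analytic there, so this is part of the definition.\<close>

definition subordinate :: "(complex \<Rightarrow> complex) \<Rightarrow> (complex \<Rightarrow> complex) \<Rightarrow> bool"
    (infix \<open>\<prec>\<close> 50)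
  where "F \<prec> G \<longleftrightarrow> F analytic_on \<D> \<and> G analytic_on \<D> \<and>
    (\<exists>w. w analytic_on \<D> \<and> w 0 = 0 \<and> (\<forall>z\<in>\<D>. norm (w z) < 1 \<and> F z = G (w z)))"

text \<open>The functions \<open>\<psi> : \<complex>\<^sup>3 \<times> \<D> \<rightarrow> \<complex>\<close> are represented by
  curried total functions whose values are constrained only for a last argument in the disc.
  The quotient \<open>t / s\<close> is a genuine one, since \<open>s \<noteq> 0\<close>.\<close>

definition admissible_exp ::
    "complex set \<Rightarrow> (complex \<Rightarrow> complex \<Rightarrow> complex \<Rightarrow> complex \<Rightarrow> complex) set"
  where "admissible_exp \<Omega> = {\<psi>. \<forall>r s t. \<forall>z\<in>\<D>. \<forall>\<theta>\<in>{0..<2 * pi}. \<forall>m::real. m \<ge> 1 \<longrightarrow>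
     r = exp (exp (\<i> * of_real \<theta>)) \<longrightarrow>
     s = of_real m * exp (\<i> * of_real \<theta>) * r \<longrightarrow>
     Re (1 + t / s) \<ge> m * (1 + cos \<theta>) \<longrightarrow>
     \<psi> r s t z \<notin> \<Omega>}"

text \<open>The condition \<open>w \<noteq> 0\<close> is needed because the library has \<open>Ln 0 = 0\<close>.\<close>

definition Delta_exp :: "complex set"
  where "Delta_exp = {w. w \<noteq> 0 \<and> norm (Ln w) < 1}"

lemma Delta_exp_eq_image: "Delta_exp = exp ` \<D>"
proof (intro set_eqI iffI)
  fix w assume "w \<in> Delta_exp"
  then have "w = exp (Ln w)" "Ln w \<in> \<D>" by (auto simp: Delta_exp_def)
  then show "w \<in> exp ` \<D>" by (rule image_eqI)
next
  fix w assume "w \<in> exp ` \<D>"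
  then obtain z where z: "w = exp z" "norm z < 1" by auto
  have "\<bar>Im z\<bar> < pi" using abs_Im_le_cmod[of z] z(2) pi_gt3 by linarith
  then have "Ln w = z" using z(1) by (simp add: Ln_exp abs_less_iff)
  then show "w \<in> Delta_exp" using z by (simp add: Delta_exp_def)
qed

end

theory Submission
  imports Defs
begin

text \<open>
  If \<open>p\<close> is not subordinate to \<open>exp\<close>, let \<open>z0\<close> be a point of least modulus with
  \<open>p z0 \<notin> exp ` \<D>\<close>. Then \<open>w = Ln \<circ> p\<close> is holomorphic near the closed disc of radius \<open>|z0|\<close>,
  has modulus below 1 inside it and modulus 1 at \<open>z0\<close>. Jack's lemma yields
  \<open>z0 w'(z0) = m w(z0)\<close> and \<open>Re (1 + z0 w''(z0) / w'(z0)) \<ge> m\<close> for some \<open>m \<ge> 1\<close>. Translated to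
  \<open>p = e\<^sup>w\<close>, this says that \<open>\<psi>\<close> is evaluated at an admissible triple, so its value is
  outside \<open>\<Omega>\<close>.

  Jack's lemma itself comes from the first and second derivative tests for \<open>|w|\<^sup>2\<close> along the
  circle \<open>z0 e\<^sup>i\<^sup>t\<close>, and \<open>m \<ge> 1\<close> from the Schwarz lemma along the radius through \<open>z0\<close>.
\<close>

section \<open>Derivative tests at a maximum\<close>

text \<open>If \<open>g2\<close> were positive, \<open>g1\<close>, which vanishes at
  \<open>a\<close>, would be positive just to the right of \<open>a\<close>, and \<open>g\<close>
  would rise above its maximum.\<close>

lemma second_derivative_nonpos_at_max:
  fixes g g1 :: "real \<Rightarrow> real"
  assumes g: "\<And>t. (g has_real_derivative g1 t) (at t)"
    and g1: "(g1 has_real_derivative g2) (at a)"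
    and max: "\<And>t. g t \<le> g a"
  shows "g1 a = 0" "g2 \<le> 0"
proof -
  show crit: "g1 a = 0"
    using DERIV_local_max[OF g, of 1 a] max by auto
  show "g2 \<le> 0"
  proof (rule ccontr)
    assume "\<not> g2 \<le> 0"
    then obtain d where d: "d > 0" "\<And>h. 0 < h \<Longrightarrow> h < d \<Longrightarrow> g1 a < g1 (a + h)"
      using DERIV_pos_inc_right[OF g1] by auto
    have "g a < g (a + d/2)"
    proof (rule DERIV_pos_imp_increasing_open[where f = g])
      fix x assume "a < x" "x < a + d/2"
      then have "g1 x > 0" using d(2)[of "x - a"] crit d(1) by simp
      then show "\<exists>y. DERIV g x :> y \<and> y > 0" using g by blast
    next
      show "continuous_on {a..a + d/2} g"
        using g by (meson DERIV_isCont continuous_at_imp_continuous_on)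
    qed (use d in simp)
    then show False using max[of "a + d/2"] by simp
  qed
qed

text \<open>These are the two tests for the squared norm \<open>h t \<bullet> h t\<close>, which is
  differentiable even where \<open>h\<close> vanishes.\<close>

lemma norm_max_curve:
  fixes h h1 :: "real \<Rightarrow> 'a::real_inner"
  assumes h: "\<And>t. (h has_vector_derivative h1 t) (at t)"
    and h1: "(h1 has_vector_derivative h2) (at a)"
    and max: "\<And>t. norm (h t) \<le> norm (h a)"
  shows "h a \<bullet> h1 a = 0" "h1 a \<bullet> h1 a + h a \<bullet> h2 \<le> 0"
proof -
  have "((\<lambda>t. h t \<bullet> h t) has_real_derivative 2 * (h t \<bullet> h1 t)) (at t)" for t
    using bounded_bilinear.has_vector_derivative[OF bounded_bilinear_inner h h, of t]
    by (simp add: has_real_derivative_iff_has_vector_derivative inner_commute)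
  moreover have "((\<lambda>t. 2 * (h t \<bullet> h1 t)) has_real_derivative 2 * (h1 a \<bullet> h1 a + h a \<bullet> h2)) (at a)"
    using DERIV_cmult[where c = 2, OF bounded_bilinear.has_vector_derivative[OF bounded_bilinear_inner h h1,
      folded has_real_derivative_iff_has_vector_derivative]]
    by (simp add: add.commute)
  moreover have "h t \<bullet> h t \<le> h a \<bullet> h a" for t
    using max[of t] by (simp add: dot_square_norm power_mono)
  ultimately have "2 * (h a \<bullet> h1 a) = 0" "2 * (h1 a \<bullet> h1 a + h a \<bullet> h2) \<le> 0"
    by (rule second_derivative_nonpos_at_max)+
  then show "h a \<bullet> h1 a = 0" "h1 a \<bullet> h1 a + h a \<bullet> h2 \<le> 0"
    by simp_all
qed

section \<open>Jack's lemma\<close>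

text \<open>With \<open>k\<close> and \<open>l\<close> as defined in the proof, the first test makes
  \<open>k\<close> real and the second gives k^2 \<le> k + Re l. Since z0 w''/w' = l/k, dividing by
  k \<ge> 1 yields the last claim with m = k.\<close>

lemma Jack_lemma:
  fixes w :: "complex \<Rightarrow> complex"
  assumes S: "open S" "cball 0 (norm z0) \<subseteq> S" and hol: "w holomorphic_on S"
    and "w 0 = 0" and lt: "\<And>z. norm z < norm z0 \<Longrightarrow> norm (w z) < 1" and eq: "norm (w z0) = 1"
  obtains m :: real where "m \<ge> 1" "z0 * deriv w z0 = of_real m * w z0"
    "Re (1 + z0 * deriv (deriv w) z0 / deriv w z0) \<ge> m"
proof -
  define c where "c t = z0 * exp (\<i> * t)" for t :: complex
  define k where "k = z0 * deriv w z0 / w z0"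
  define l where "l = z0\<^sup>2 * deriv (deriv w) z0 / w z0"
  have z0: "z0 \<noteq> 0" and w0: "w z0 \<noteq> 0" using eq \<open>w 0 = 0\<close> by auto
  have le: "norm (w z) \<le> 1" if "norm z \<le> norm z0" for z
  proof (rule continuous_on_closure_norm_le[of "ball 0 (norm z0)" w])
    show "continuous_on (closure (ball 0 (norm z0))) w"
      using holomorphic_on_imp_continuous_on[OF hol] S(2) z0
      by (simp add: continuous_on_subset)
  qed (use that z0 lt in \<open>auto simp: less_imp_le\<close>)
  have dw: "(w has_field_derivative deriv w z) (at z)" if "norm z \<le> norm z0" for z
    using that S by (intro holomorphic_derivI[OF hol]) auto
  have dw': "(deriv w has_field_derivative deriv (deriv w) z) (at z)" if "norm z \<le> norm z0" for z
    using that S by (intro holomorphic_derivI[OF holomorphic_deriv[OF hol]]) auto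
  have cn: "norm (c (of_real t)) \<le> norm z0" for t
    by (simp add: c_def norm_mult)
  have c0: "c 0 = z0" by (simp add: c_def)
  have dc: "(c has_field_derivative \<i> * c t) (at t)" for t
    unfolding c_def by (auto intro!: derivative_eq_intros)
  have h: "((\<lambda>t. w (c (of_real t))) has_vector_derivative
      deriv w (c (of_real t)) * (\<i> * c (of_real t))) (at t)" for t
    by (intro has_vector_derivative_real_field DERIV_chain2[OF dw[OF cn] dc])
  \<comment> \<open>Since c' = i c, both terms of the product rule carry the factor i^2 =
    -1.\<close>
  have h1: "((\<lambda>t. deriv w (c (of_real t)) * (\<i> * c (of_real t))) has_vector_derivative
      - (z0 * deriv w z0 + z0\<^sup>2 * deriv (deriv w) z0)) (at 0)"
  proof (rule has_vector_derivative_real_field)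
    show "((\<lambda>t. deriv w (c t) * (\<i> * c t)) has_field_derivative
        - (z0 * deriv w z0 + z0\<^sup>2 * deriv (deriv w) z0)) (at (of_real 0))"
      using DERIV_mult[OF DERIV_chain2[OF dw' dc, of "of_real 0"] DERIV_cmult[OF dc, of \<i>]] cn[of 0]
      by (simp add: c0 power2_eq_square algebra_simps)
  qed
  have max: "norm (w (c (of_real t))) \<le> norm (w (c (of_real 0)))" for t
    using le[OF cn] eq by (simp add: c0)
  \<comment> \<open>Multiplication by the unimodular \<open>w z0\<close> is an isometry, so it
    cancels from the real inner product.\<close>
  have inner: "(w z0) \<bullet> (w z0 * u) = Re u" for u
  proof -
    have "(w z0) \<bullet> (w z0 * u) = (norm (w z0))\<^sup>2 * Re u"
      unfolding cmod_power2 by (simp add: inner_complex_def power2_eq_square algebra_simps)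
    then show ?thesis using eq by simp
  qed
  have e1: "z0 * deriv w z0 = w z0 * k" and e2: "z0\<^sup>2 * deriv (deriv w) z0 = w z0 * l"
    using w0 by (simp_all add: k_def l_def)
  have "w z0 \<bullet> (w z0 * (\<i> * k)) = 0"
    using norm_max_curve(1)[OF h h1 max] e1 by (simp add: c0 mult.commute mult.left_commute)
  then have Imk: "Im k = 0" unfolding inner by simp
  have kk: "k = of_real (Re k)" by (simp add: complex_eq_iff Imk)
  have "norm (w z0 * (\<i> * k)) ^ 2 + w z0 \<bullet> (w z0 * - (k + l)) \<le> 0"
    using norm_max_curve(2)[OF h h1 max] e1 e2
    by (simp add: c0 dot_square_norm algebra_simps)
  then have second: "(Re k)\<^sup>2 \<le> Re k + Re l"
    unfolding inner norm_mult eq by (subst (asm) (1) kk) simp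
  \<comment> \<open>By the Schwarz lemma |w(u z0)|^2 - u^2 \<le> 0 for 0 < u < 1, with equality at u
    = 1. If Re k < 1, its derivative 2 Re k - 2 at 1 would be negative, making it positive just to
    the left of 1.\<close>
  have "Re k \<ge> 1"
  proof (rule ccontr)
    assume k1: "\<not> Re k \<ge> 1"
    define f where "f u = w (of_real u * z0)" for u :: real
    have df: "(f has_vector_derivative w z0 * k) (at 1)"
      unfolding f_def e1[symmetric]
    proof (rule has_vector_derivative_real_field)
      have "((\<lambda>u. u * z0) has_field_derivative z0) (at 1)"
        by (auto intro!: derivative_eq_intros)
      then show "((\<lambda>u. w (u * z0)) has_field_derivative z0 * deriv w z0) (at (of_real 1))"
        using DERIV_chain2[of w "deriv w z0" "\<lambda>u. u * z0" 1 z0 UNIV] dw[of z0]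
        by (simp add: mult.commute)
    qed
    have "((\<lambda>u. f u \<bullet> f u - u\<^sup>2) has_real_derivative 2 * Re k - 2) (at 1)"
    proof -
      have "((\<lambda>u. f u \<bullet> f u) has_real_derivative 2 * Re k) (at 1)"
        using bounded_bilinear.has_vector_derivative[OF bounded_bilinear_inner df df]
        by (simp add: has_real_derivative_iff_has_vector_derivative f_def inner inner_commute)
      then show ?thesis by (auto intro!: derivative_eq_intros)
    qed
    from DERIV_neg_dec_left[OF this] k1 obtain d where d: "d > 0"
      "\<And>h. 0 < h \<Longrightarrow> h < d \<Longrightarrow> f 1 \<bullet> f 1 - 1 < f (1 - h) \<bullet> f (1 - h) - (1 - h)\<^sup>2" by auto
    \<comment> \<open>The bound d/2 keeps the step within the range of \<open>d\<close>, and 1/2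
      keeps \<open>u\<close> positive.\<close>
    define u where "u = 1 - min (d/2) (1/2)"
    have u: "0 < u" "u < 1" using d by (auto simp: u_def)
    have gt: "u\<^sup>2 < (norm (f u))\<^sup>2"
      using d(2)[of "min (d/2) (1/2)"] d(1) eq by (auto simp: u_def f_def dot_square_norm)
    have bound: "norm (v * z0) < norm z0" if "norm v < 1" for v :: complex
      using that z0 by (simp add: norm_mult)
    have "norm (w (of_real u * z0)) \<le> norm (of_real u :: complex)"
    proof (rule Schwarz_Lemma(1)[of "\<lambda>u. w (u * z0)"])
      show "(\<lambda>u. w (u * z0)) holomorphic_on ball 0 1"
      proof (rule holomorphic_on_compose_gen[of "\<lambda>u. u * z0" _ w S, unfolded o_def, OF _ hol])
        show "(\<lambda>u. u * z0) ` ball 0 1 \<subseteq> S"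
          using S(2) bound by (force simp: subset_iff less_imp_le)
      qed (auto intro!: holomorphic_intros)
    qed (use \<open>w 0 = 0\<close> u lt bound in auto)
    then show False using power2_less_imp_less[OF gt] u by (simp add: f_def)
  qed
  moreover have "z0 * deriv w z0 = of_real (Re k) * w z0"
    using e1 kk by (metis mult.commute)
  moreover have "Re (1 + z0 * deriv (deriv w) z0 / deriv w z0) \<ge> Re k"
  proof -
    have "z0 * deriv (deriv w) z0 / deriv w z0 = l / k"
      using z0 w0 by (simp add: k_def l_def power2_eq_square)
    then have "Re (1 + z0 * deriv (deriv w) z0 / deriv w z0) = 1 + Re l / Re k"
      by (subst (asm) kk) simp
    moreover have "Re k \<le> 1 + Re l / Re k"
      using second \<open>Re k \<ge> 1\<close> by (simp add: field_simps power2_eq_square)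
    ultimately show ?thesis by linarith
  qed
  ultimately show ?thesis by (rule that)
qed

section \<open>The image of the disc under exp\<close>

text \<open>Since 1 < pi, the closed disc lies in the strip where \<open>Ln\<close> inverts
  \<open>exp\<close>; on the branch cut the imaginary part of \<open>Ln\<close> would be pi. The
  closed disc is taken because the extremal value of \<open>p\<close> is a boundary point.\<close>

lemma exp_cball_Ln:
  assumes "z \<in> exp ` cball 0 1"
  shows "z \<notin> \<real>\<^sub>\<le>\<^sub>0" "norm (Ln z) \<le> 1"
proof -
  obtain v where v: "z = exp v" "norm v \<le> 1" using assms by auto
  have *: "\<bar>Im v\<bar> < pi" using abs_Im_le_cmod[of v] v(2) pi_gt3 by linarith
  then have Ln: "Ln z = v" using v(1) by (simp add: Ln_exp abs_less_iff)
  then show "norm (Ln z) \<le> 1" using v by simp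
  show "z \<notin> \<real>\<^sub>\<le>\<^sub>0"
  proof
    assume "z \<in> \<real>\<^sub>\<le>\<^sub>0"
    moreover have "z \<noteq> 0" using v by simp
    ultimately have "Im (Ln z) = pi"
      by (auto simp: Im_Ln_eq_pi complex_nonpos_Reals_iff complex_eq_iff)
    then show False using * Ln by simp
  qed
qed

text \<open>Imaginary parts in the disc differ by less than 2 pi, so \<open>exp\<close> is injective
  there and the open mapping theorem applies. Openness later makes the set of bad points
  closed.\<close>

lemma open_Delta_exp: "open Delta_exp"
proof -
  have "inj_on exp \<D>"
  proof (rule inj_onI)
    fix x y :: complex assume "x \<in> \<D>" "y \<in> \<D>" "exp x = exp y"
    then have "\<bar>Im x - Im y\<bar> < 2 * pi"
      using abs_Im_le_cmod[of x] abs_Im_le_cmod[of y] pi_gt3 unfolding mem_ball_0 by linarith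
    then show "x = y" using \<open>exp x = exp y\<close> by (rule exp_complex_eqI)
  qed
  then show ?thesis
    unfolding Delta_exp_eq_image by (intro open_mapping_thm3) (auto intro!: holomorphic_intros)
qed

section \<open>From admissibility to subordination\<close>

text \<open>Common core of both parts of the theorem: the second one takes \<open>Delta_exp\<close>
  for \<open>\<Omega>\<close>.\<close>

lemma admissible_imp_subordinate:
  assumes p: "p \<in> \<H>\<^sub>1" and adm: "\<psi> \<in> admissible_exp \<Omega>"
    and val: "\<And>z. z \<in> \<D> \<Longrightarrow> \<psi> (p z) (z * deriv p z) (z\<^sup>2 * (deriv ^^ 2) p z) z \<in> \<Omega>"
  shows "p \<prec> exp"
proof -
  have pan: "p analytic_on \<D>" using p by (simp add: H1_def)
  then have phol: "p holomorphic_on \<D>" by (simp add: analytic_on_open)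
  then have pcont: "continuous_on \<D> p" by (rule holomorphic_on_imp_continuous_on)
  have p0: "p 0 = 1"
  proof -
    obtain a :: "nat \<Rightarrow> complex" where "a 0 = 1" "\<forall>z\<in>\<D>. (\<lambda>n. a n * z ^ n) sums p z"
      using p by (auto simp: H1_def)
    then show ?thesis using powser_sums_zero[of a] sums_unique2[of _ "p 0" 1] by force
  qed
  \<comment> \<open>On \<open>S\<close> the values of \<open>p\<close> avoid 0 and the branch cut,
    so Ln p is a holomorphic logarithm of \<open>p\<close>.\<close>
  define S where "S = {z \<in> \<D>. p z \<notin> \<real>\<^sub>\<le>\<^sub>0}"
  have "open S"
  proof -
    have "open (\<D> \<inter> p -` (- \<real>\<^sub>\<le>\<^sub>0))"
      by (intro continuous_open_preimage pcont open_Compl closed_nonpos_Reals_complex open_ball)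
    moreover have "S = \<D> \<inter> p -` (- \<real>\<^sub>\<le>\<^sub>0)" by (auto simp: S_def)
    ultimately show ?thesis by simp
  qed
  define w where "w z = Ln (p z)" for z
  have whol: "w holomorphic_on S"
    unfolding w_def
    by (intro holomorphic_on_Ln' holomorphic_on_subset[OF phol]) (auto simp: S_def)
  have pw: "p z = exp (w z)" if "z \<in> S" for z
  proof -
    have "p z \<noteq> 0" using that by (auto simp: S_def)
    then show ?thesis by (simp add: w_def)
  qed
  have w0: "w 0 = 0" by (simp add: w_def p0)
  have Delta_sub: "Delta_exp \<subseteq> exp ` cball 0 1" by (auto simp: Delta_exp_eq_image)
  show ?thesis
  proof (cases "\<forall>z\<in>\<D>. p z \<in> Delta_exp")
    case True
    then have "S = \<D>" using exp_cball_Ln(1) Delta_sub by (auto simp: S_def)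
    then have "w analytic_on \<D>" using whol by (simp add: analytic_on_open)
    moreover have "\<forall>z\<in>\<D>. norm (w z) < 1"
      using True by (simp add: Delta_exp_def w_def)
    moreover have "exp analytic_on \<D>" by (auto intro!: analytic_intros)
    ultimately show ?thesis using pan w0 pw \<open>S = \<D>\<close> unfolding subordinate_def by blast
  next
    case False
    then obtain z1 where z1: "z1 \<in> \<D>" "p z1 \<notin> Delta_exp" by auto
    \<comment> \<open>Cutting down to the closed disc through \<open>z1\<close> gives compactness;
      bad points outside it have larger modulus than \<open>z1\<close>, so the minimum is
      global.\<close>
    define K where "K = cball 0 (norm z1) \<inter> p -` (- Delta_exp)"
    have "continuous_on (cball 0 (norm z1)) p"
      using z1 by (intro continuous_on_subset[OF pcont]) auto
    then have "closed K"
      unfolding K_def by (rule continuous_closed_preimage) (use open_Delta_exp in auto)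
    then have "compact K"
      by (simp add: K_def compact_eq_bounded_closed bounded_Int)
    moreover have "K \<noteq> {}" using z1 by (auto simp: K_def)
    ultimately obtain z0 where z0: "z0 \<in> K" "\<And>z. z \<in> K \<Longrightarrow> norm z0 \<le> norm z"
      using continuous_attains_inf[of K norm] by (auto intro: continuous_intros)
    have z0D: "norm z0 < 1" and pz0: "p z0 \<notin> Delta_exp" and z01: "norm z0 \<le> norm z1"
      using z0(1) z1 by (auto simp: K_def)
    have in_Delta: "p z \<in> Delta_exp" if "norm z < norm z0" for z
      using z0(2)[of z] z01 that by (auto simp: K_def)
    \<comment> \<open>This makes the closure of the open disc of radius |z0| the closed disc rather
      than the empty set.\<close>
    have z0nz: "z0 \<noteq> 0" using pz0 p0 by (auto simp: Delta_exp_def)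
    have in_exp: "p z \<in> exp ` cball 0 1" if "norm z \<le> norm z0" for z
    proof -
      have "p ` closure (ball 0 (norm z0)) \<subseteq> exp ` cball 0 1"
      proof (rule image_closure_subset)
        show "continuous_on (closure (ball 0 (norm z0))) p"
          using z0D z0nz by (intro continuous_on_subset[OF pcont]) auto
        show "closed (exp ` cball 0 1 :: complex set)"
          by (intro compact_imp_closed compact_continuous_image continuous_intros) auto
        show "p ` ball 0 (norm z0) \<subseteq> exp ` cball 0 1"
          using in_Delta Delta_sub by auto
      qed
      then show ?thesis using that z0nz by auto
    qed
    have sub: "cball 0 (norm z0) \<subseteq> S"
      using in_exp exp_cball_Ln(1) z0D by (auto simp: S_def)
    have z0S: "z0 \<in> S" using sub by auto
    have wlt: "norm (w z) < 1" if "norm z < norm z0" for z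
      using in_Delta[OF that] by (simp add: w_def Delta_exp_def)
    \<comment> \<open>The modulus is at most 1 by continuity of \<open>p\<close> up to the circle,
      and not below 1 because \<open>p z0\<close> is outside \<open>Delta_exp\<close>.\<close>
    have weq: "norm (w z0) = 1"
      using exp_cball_Ln[OF in_exp[of z0]] pz0 by (fastforce simp: w_def Delta_exp_def)
    obtain m where m: "m \<ge> 1" "z0 * deriv w z0 = of_real m * w z0"
      "Re (1 + z0 * deriv (deriv w) z0 / deriv w z0) \<ge> m"
      using Jack_lemma[OF \<open>open S\<close> sub whol w0 wlt weq] by blast
    have dw: "(w has_field_derivative deriv w z) (at z)" if "z \<in> S" for z
      using that \<open>open S\<close> by (intro holomorphic_derivI[OF whol])
    have dw': "(deriv w has_field_derivative deriv (deriv w) z) (at z)" if "z \<in> S" for z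
      using that \<open>open S\<close> by (intro holomorphic_derivI[OF holomorphic_deriv[OF whol]])
    have dp: "deriv p z = exp (w z) * deriv w z" if "z \<in> S" for z
    proof (rule DERIV_imp_deriv)
      show "(p has_field_derivative exp (w z) * deriv w z) (at z)"
        by (rule has_field_derivative_transform_within_open
            [OF DERIV_chain2[OF DERIV_exp dw[OF that]] \<open>open S\<close> that]) (simp add: pw)
    qed
    have ddp: "deriv (deriv p) z0 = exp (w z0) * (deriv (deriv w) z0 + (deriv w z0)\<^sup>2)"
    proof (rule DERIV_imp_deriv)
      have "((\<lambda>z. exp (w z) * deriv w z) has_field_derivative
          exp (w z0) * (deriv (deriv w) z0 + (deriv w z0)\<^sup>2)) (at z0)"
        by (rule derivative_eq_intros dw[OF z0S] dw'[OF z0S] refl)+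
          (simp add: power2_eq_square algebra_simps)
      then show "(deriv p has_field_derivative
          exp (w z0) * (deriv (deriv w) z0 + (deriv w z0)\<^sup>2)) (at z0)"
        by (rule has_field_derivative_transform_within_open[OF _ \<open>open S\<close> z0S]) (simp add: dp)
    qed
    \<comment> \<open>\<open>Arg2pi\<close> has the range [0, 2 pi) demanded by
      admissibility.\<close>
    define \<theta> where "\<theta> = Arg2pi (w z0)"
    have \<theta>: "w z0 = exp (\<i> * of_real \<theta>)" "\<theta> \<in> {0..<2*pi}"
      using Arg2pi[of "w z0"] weq by (auto simp: \<theta>_def is_Arg_def)
    have Rew: "Re (w z0) = cos \<theta>" by (simp add: \<theta>(1) Re_exp)
    have s: "z0 * deriv p z0 = of_real m * w z0 * p z0"
      using m(2) by (simp add: dp[OF z0S] pw[OF z0S] mult_ac)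
    have dw0: "deriv w z0 \<noteq> 0" using m(1,2) weq by auto
    \<comment> \<open>From p = e^w the quotient is z0 w''/w' + z0 w', and z0 w' = m w(z0) has real
      part m cos \<theta>, which supplies the cosine term of the admissibility bound.\<close>
    have "(z0\<^sup>2 * deriv (deriv p) z0) / (z0 * deriv p z0)
        = z0 * deriv (deriv w) z0 / deriv w z0 + of_real m * w z0"
      unfolding ddp dp[OF z0S] m(2)[symmetric] using z0nz dw0
      by (simp add: field_simps power2_eq_square)
    then have ge: "Re (1 + (z0\<^sup>2 * (deriv ^^ 2) p z0) / (z0 * deriv p z0)) \<ge> m * (1 + cos \<theta>)"
      using m(3) Rew by (simp add: numeral_2_eq_2 algebra_simps)
    have "\<psi> (p z0) (z0 * deriv p z0) (z0\<^sup>2 * (deriv ^^ 2) p z0) z0 \<notin> \<Omega>"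
      using adm[unfolded admissible_exp_def mem_Collect_eq, rule_format,
          OF _ \<theta>(2) m(1) _ _ ge] z0D pw[OF z0S] s \<theta>(1) by simp
    then show ?thesis using val[of z0] z0D by simp
  qed
qed

theorem theorem2p1:
  fixes p :: "complex \<Rightarrow> complex"
  assumes "p \<in> \<H>\<^sub>1"
  shows "(\<forall>\<Omega> \<psi>. open \<Omega> \<longrightarrow> connected \<Omega> \<longrightarrow> \<Omega> \<noteq> {} \<longrightarrow> \<psi> \<in> admissible_exp \<Omega> \<longrightarrow>
            (\<forall>z\<in>\<D>. \<psi> (p z) (z * deriv p z) (z\<^sup>2 * (deriv ^^ 2) p z) z \<in> \<Omega>) \<longrightarrow>
            p \<prec> exp) \<and>
         (\<forall>\<psi>. \<psi> \<in> admissible_exp Delta_exp \<longrightarrow>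
            (\<lambda>z. \<psi> (p z) (z * deriv p z) (z\<^sup>2 * (deriv ^^ 2) p z) z) \<prec> exp \<longrightarrow>
            p \<prec> exp)"
proof (intro conjI allI impI)
  fix \<Omega> \<psi>
  assume "\<psi> \<in> admissible_exp \<Omega>"
    "\<forall>z\<in>\<D>. \<psi> (p z) (z * deriv p z) (z\<^sup>2 * (deriv ^^ 2) p z) z \<in> \<Omega>"
  then show "p \<prec> exp" using admissible_imp_subordinate[OF assms] by blast
next
  fix \<psi>
  assume adm: "\<psi> \<in> admissible_exp Delta_exp"
    and sub: "(\<lambda>z. \<psi> (p z) (z * deriv p z) (z\<^sup>2 * (deriv ^^ 2) p z) z) \<prec> exp"
  \<comment> \<open>The subordinating function maps into the disc, so these values are exponentials
    of disc points.\<close>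
  then have "\<psi> (p z) (z * deriv p z) (z\<^sup>2 * (deriv ^^ 2) p z) z \<in> Delta_exp" if "z \<in> \<D>" for z
    using that unfolding subordinate_def Delta_exp_eq_image by force
  then show "p \<prec> exp" by (rule admissible_imp_subordinate[OF assms adm])
qed

end
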